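(* For every integer $n\ge0$ let $$P_n=P_n(q)=\sum_{j\ge0}\sum_{k\ge0}q^{j^2+j+k^2+k}\begin{bmatrix} j\\ k\end{bmatrix}_{q^2}\begin{bmatrix} n+j-k+1\\ 2j+1\end{bmatrix}_{q}.$$ Then $$P_n=\sum_{j=-\infty}^\infty q^{3j^2+2j}\,T_1(n+1,3j+1;q),$$ and $P_0=1$, $P_1=q^2+q+1$, and $P_n=(1+q+q^{2n})P_{n-1}+(q^{2n}-q)P_{n-2}$ for $n\ge2$.
   Context: $q$ is an indeterminate. $(a;p)_n=\prod_{i=0}^{n-1}(1-ap^i)$. The Gaussian polynomial in base $p$ is $\begin{bmatrix} A\\ B\end{bmatrix}_{p}=\frac{(p;p)_A}{(p;p)_B(p;p)_{A-B}}$ if $0\le B\le A$, and $0$ otherwise. For integers $L\ge0$ and $A$, $$T_1(L,A;q)=\sum_{r=0}^L(-q)^r\begin{bmatrix} L\\ r\end{bmatrix}_{q^2}\begin{bmatrix} 2L-2r\\ L-A-r\end{bmatrix}_{q}.$$ All sums have only finitely many nonzero terms. *)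

theory Defs
  imports
    "HOL-Computational_Algebra.Polynomial"
    "HOL-Computational_Algebra.Fraction_Field"
    "HOL-Library.Groups_Big_Fun"
begin

text \<open>
  The indeterminate \<open>q\<close> is an element of the field of rational functions, realised as
  the field of fractions of \<open>\<int>[q]\<close>; the Gaussian polynomials, being quotients, live there as well.
\<close>

definition qvar :: "int poly fract" where
  "qvar = Fract [:0, 1:] 1"

definition qpoch :: "'a::comm_ring_1 \<Rightarrow> 'a \<Rightarrow> nat \<Rightarrow> 'a" where
  "qpoch a p n = (\<Prod>i<n. 1 - a * p ^ i)"

definition gauss_poly :: "'a::field \<Rightarrow> int \<Rightarrow> int \<Rightarrow> 'a" where
  "gauss_poly p A B =
     (if 0 \<le> B \<and> B \<le> A
      then qpoch p p (nat A) / (qpoch p p (nat B) * qpoch p p (nat (A - B)))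
      else 0)"

definition T1 :: "nat \<Rightarrow> int \<Rightarrow> 'a::field \<Rightarrow> 'a" where
  "T1 L A q =
     (\<Sum>r=0..L. (- q) ^ r * gauss_poly (q ^ 2) (int L) (int r)
                * gauss_poly q (2 * int L - 2 * int r) (int L - A - int r))"

text \<open>
  \<open>Sum_any\<close> adds up the nonzero values of a function and is \<open>0\<close> by convention if there are
  infinitely many; the two finiteness lemmas below show that this never happens here.
\<close>

definition P_summand :: "nat \<Rightarrow> 'a::field \<Rightarrow> nat \<Rightarrow> nat \<Rightarrow> 'a" where
  "P_summand n q j k =
     q ^ (j\<^sup>2 + j + k\<^sup>2 + k) * gauss_poly (q ^ 2) (int j) (int k)
       * gauss_poly q (int n + int j - int k + 1) (2 * int j + 1)"

definition P_poly :: "nat \<Rightarrow> 'a::field \<Rightarrow> 'a" where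
  "P_poly n q = Sum_any (\<lambda>(j, k). P_summand n q j k)"

lemma finite_P_support: "finite {(j, k). P_summand n q j k \<noteq> 0}"
proof (rule finite_subset)
  show "{(j, k). P_summand n q j k \<noteq> 0} \<subseteq> {..n} \<times> {..n}"
    by (auto simp: P_summand_def gauss_poly_def split: if_splits)
qed simp

lemma T1_eq_0: "T1 L A q = 0" if "\<bar>A\<bar> > int L"
  unfolding T1_def gauss_poly_def using that by (intro sum.neutral) auto

lemma finite_T1_support: "finite {j::int. q powi (3 * j\<^sup>2 + 2 * j) * T1 L (3 * j + 1) q \<noteq> 0}"
proof (rule finite_subset)
  show "{j::int. q powi (3 * j\<^sup>2 + 2 * j) * T1 L (3 * j + 1) q \<noteq> 0} \<subseteq> {- int L - 1 .. int L + 1}"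
  proof
    fix j :: int
    assume "j \<in> {j. q powi (3 * j\<^sup>2 + 2 * j) * T1 L (3 * j + 1) q \<noteq> 0}"
    then have "\<not> \<bar>3 * j + 1\<bar> > int L" using T1_eq_0[of L "3 * j + 1" q] by auto
    then show "j \<in> {- int L - 1 .. int L + 1}" by auto
  qed
qed simp

end

theory Submission
  imports Defs
begin

text \<open>
  The double sum and the trinomial sum satisfy the same second-order recurrence and have the same
  initial values. The recurrences come from opposite directions.

  For the double sum, the generating function is
  \<open>\<Sum>\<^sub>n P\<^sub>n z\<^sup>n = \<Sum>\<^sub>j q\<^bsup>j\<^sup>2+j\<^esup> z\<^sup>j (-zq\<^sup>2;q\<^sup>2)\<^sub>j / (z;q)\<^bsub>2j+2\<^esub>\<close>. For \<open>j > 0\<close>, multiplying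
  its \<open>j\<close>-th term by \<open>(1-z)(1-qz)\<close> gives exactly \<open>zq\<^sup>2(1+zq\<^sup>2)\<close> times the term of index \<open>j-1\<close> taken
  at \<open>zq\<^sup>2\<close>; for \<open>j = 0\<close> it gives \<open>1\<close>. On coefficients, this says that the second difference of the
  \<open>j\<close>-th layer is \<open>q\<^bsup>2n\<^esup>\<close> times the sum of two consecutive values of the layer \<open>j-1\<close> (\<open>layer_Suc\<close>);
  summing over \<open>j\<close> gives \<open>P_poly_rec\<close>.

  For the trinomial sum, \<open>T\<^sub>1\<close> needs its companion \<open>T\<^sub>0\<close>, in which the factor \<open>(-q)\<^sup>r\<close> is replaced by
  \<open>(-1)\<^sup>r\<close>. Both are convolutions of the central coefficients \<open>[2m; m-A]\<close> with the Gaussian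
  coefficients in base \<open>q\<^sup>2\<close>, and Pascal's rule for both factors produces (\<open>T1_Suc\<close>, \<open>T0_Suc\<close>)

  \<open>T\<^sub>1(L+1,A) = T\<^sub>1(L,A) + q\<^bsup>L+1+A\<^esup> T\<^sub>0(L,A+1) + q\<^bsup>L+1-A\<^esup> T\<^sub>0(L,A-1)\<close>,

  \<open>T\<^sub>0(L+1,A) = T\<^sub>0(L,A+1) + q\<^bsup>L+1-A\<^esup> T\<^sub>1(L,A-1) + q\<^bsup>2L+1\<^esup> T\<^sub>0(L,A)\<close>.

  Let \<open>U\<^sub>L\<close> be the sum of \<open>q\<^bsup>3j\<^sup>2+2j\<^esup> T\<^sub>1(L,3j+1)\<close> and let \<open>Y\<^sub>L\<close> be the sum of the terms
  \<open>q\<^bsup>3j\<^sup>2+5j+2\<^esup> T\<^sub>0(L,3j+2)\<close> and \<open>q\<^bsup>3j\<^sup>2-j\<^esup> T\<^sub>0(L,3j)\<close>. Under these weights the three residue classes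
  modulo \<open>3\<close> are mapped into one another, and the system closes up:
  \<open>U\<^bsub>L+1\<^esub> = U\<^sub>L + q\<^sup>L Y\<^sub>L\<close> and \<open>Y\<^bsub>L+1\<^esub> = (1 + q\<^bsup>2L+1\<^esup>) Y\<^sub>L + 2q\<^bsup>L+1\<^esup> U\<^sub>L\<close>. Eliminating \<open>Y\<close> gives the
  recurrence of \<open>P\<close>, with \<open>U\<^sub>0 = 0\<close> and \<open>U\<^sub>1 = 1\<close>.
\<close>

section \<open>Gaussian binomial coefficients\<close>

text \<open>
  These are the conditions under which all the \<open>qpoch q q n\<close> are invertible and integer powers of
  \<open>q\<close> add up. They pass from \<open>q\<close> to \<open>q\<^sup>2\<close>, so the lemmas below apply to both bases.
\<close>
definition generic :: "'a::field \<Rightarrow> bool" where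
  "generic q \<longleftrightarrow> q \<noteq> 0 \<and> (\<forall>n>0. q ^ n \<noteq> 1)"

lemma generic_power: "generic (q ^ k)" if "generic q" "k > 0" for q :: "'a::field"
  using that by (auto simp: generic_def simp flip: power_mult)

lemma qpoch_Suc: "qpoch a p (Suc n) = qpoch a p n * (1 - a * p ^ n)"
  by (simp add: qpoch_def)

lemma qpoch_nonzero: "qpoch q q n \<noteq> 0" if "generic q"
  using that by (induction n) (auto simp: qpoch_def generic_def simp flip: power_Suc)

lemma gauss_0_right [simp]: "gauss_poly q N 0 = 1" if "generic q" "N \<ge> 0"
  using that qpoch_nonzero[of q "nat N"] by (simp add: gauss_poly_def qpoch_def)

lemma gauss_outside: "gauss_poly q N K = 0" if "K < 0 \<or> K > N"
  using that by (auto simp: gauss_poly_def)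

lemma gauss_symmetric: "gauss_poly q N (N - K) = gauss_poly q N K"
  by (auto simp: gauss_poly_def mult.commute)

lemma gauss_lower_top:
  assumes "generic q" "N \<ge> 0"
  shows "(1 - q powi (N - K)) * gauss_poly q N K = (1 - q powi N) * gauss_poly q (N - 1) K"
proof (cases "0 \<le> K \<and> K < N")
  case True
  define k where "k = nat K"
  define m where "m = nat (N - K - 1)"
  have N: "N = int (Suc (k + m))" and K: "K = int k" using True by (auto simp: k_def m_def)
  have [simp]: "nat (1 + (int k + int m)) = Suc (k + m)" "nat (1 + int m) = Suc m"
    "nat (int k + int m) = k + m" by auto
  have nz: "1 - q * q ^ m \<noteq> 0"
    using assms(1) by (auto simp: generic_def simp flip: power_Suc)
  have pw: "q powi (1 + (int k + int m)) = q * q ^ (k + m)" "q powi (1 + int m) = q * q ^ m"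
    using power_int_of_nat[of q "Suc (k + m)"] power_int_of_nat[of q "Suc m"]
    by (simp_all del: power_int_of_nat)
  show ?thesis
    using qpoch_nonzero[OF assms(1)] nz
    by (simp add: N K gauss_poly_def qpoch_Suc pw field_simps)
next
  case False
  then show ?thesis by (cases "K = N") (auto simp: gauss_outside)
qed

lemma gauss_lower_both:
  assumes "generic q" "N \<ge> 0"
  shows "(1 - q powi K) * gauss_poly q N K = (1 - q powi N) * gauss_poly q (N - 1) (K - 1)"
  using gauss_lower_top[OF assms, of "N - K"] gauss_symmetric[of q N K]
    gauss_symmetric[of q "N - 1" "K - 1"] by simp

lemma gauss_absorb:
  assumes "generic q" "N \<ge> 0"
  shows "(1 - q powi K) * gauss_poly q N K = (1 - q powi (N - K + 1)) * gauss_poly q N (K - 1)"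
proof -
  have "N - (K - 1) = N - K + 1" by simp
  then show ?thesis
    using gauss_lower_both[OF assms, of K] gauss_lower_top[OF assms, of "K - 1"]
    by (simp only:)
qed

lemma generic_power_int: "q powi N \<noteq> 1" if "generic q" "N > 0"
proof -
  have "q powi N = q ^ nat N" using that by (simp add: power_int_def)
  then show ?thesis using that by (simp add: generic_def)
qed

text \<open>
  Both rules hold for every integer \<open>K\<close>, including the values where some of the coefficients vanish
  by convention. Multiplication by \<open>1 - q\<^sup>N\<close> turns the right-hand sides into multiples of
  \<open>[N; K]\<close>, with factors that add up to \<open>1 - q\<^sup>N\<close>.
\<close>
lemma
  assumes q: "generic q" and N: "N > 0"
  shows gauss_pascal: "gauss_poly q N K
           = gauss_poly q (N - 1) K + q powi (N - K) * gauss_poly q (N - 1) (K - 1)"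
    and gauss_pascal': "gauss_poly q N K
           = gauss_poly q (N - 1) (K - 1) + q powi K * gauss_poly q (N - 1) K"
proof -
  have nz: "1 - q powi N \<noteq> 0" using generic_power_int[OF q N] by simp
  have pw: "q powi (N - K) * q powi K = q powi N"
    using q by (simp add: generic_def flip: power_int_add)
  note low = gauss_lower_top[OF q, of N K, symmetric] gauss_lower_both[OF q, of N K, symmetric]
  have "(1 - q powi N) * (gauss_poly q (N - 1) K + q powi (N - K) * gauss_poly q (N - 1) (K - 1))
      = (1 - q powi N) * gauss_poly q (N - 1) K
          + q powi (N - K) * ((1 - q powi N) * gauss_poly q (N - 1) (K - 1))"
    by (simp add: algebra_simps)
  also have "\<dots> = (1 - q powi (N - K)) * gauss_poly q N K
          + q powi (N - K) * ((1 - q powi K) * gauss_poly q N K)"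
    using N by (simp add: low)
  also have "\<dots> = (1 - q powi N) * gauss_poly q N K"
    unfolding pw[symmetric] by (simp add: algebra_simps)
  finally show "gauss_poly q N K
           = gauss_poly q (N - 1) K + q powi (N - K) * gauss_poly q (N - 1) (K - 1)"
    using nz by simp
  have "(1 - q powi N) * (gauss_poly q (N - 1) (K - 1) + q powi K * gauss_poly q (N - 1) K)
      = (1 - q powi N) * gauss_poly q (N - 1) (K - 1)
          + q powi K * ((1 - q powi N) * gauss_poly q (N - 1) K)"
    by (simp add: algebra_simps)
  also have "\<dots> = (1 - q powi K) * gauss_poly q N K
          + q powi K * ((1 - q powi (N - K)) * gauss_poly q N K)"
    using N by (simp add: low)
  also have "\<dots> = (1 - q powi N) * gauss_poly q N K"
    unfolding pw[symmetric] by (simp add: algebra_simps)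
  finally show "gauss_poly q N K
           = gauss_poly q (N - 1) (K - 1) + q powi K * gauss_poly q (N - 1) K"
    using nz by simp
qed

text \<open>
  In terms of \<open>\<Sum>\<^sub>N [N; M] z\<^bsup>N-M\<^esup> = 1 / (z;q)\<^bsub>M+1\<^esub>\<close> this is the cancellation of the first two factors
  of the denominator. At \<open>N = M = 1\<close> the left-hand side would be \<open>1\<close> and the right-hand side \<open>0\<close>, so
  the bound on \<open>N\<close> is sharp.
\<close>
lemma gauss_second_difference:
  assumes q: "generic q" and N: "N \<ge> 2"
  shows "gauss_poly q N M - (1 + q) * gauss_poly q (N - 1) M + q * gauss_poly q (N - 2) M
       = q powi (2 * (N - M)) * gauss_poly q (N - 2) (M - 2)"
proof -
  have q0: "q \<noteq> 0" using q by (simp add: generic_def)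
  define x where "x = q powi (N - 1 - M)"
  have pw: "q powi (N - M) = q * x"
    using q0 power_int_add_1'[of q "N - 1 - M"] by (simp add: x_def)
  have sq: "q powi (2 * (N - M)) = (q * x) * (q * x)"
    unfolding pw[symmetric] using q0 by (simp flip: power_int_add)
  have "gauss_poly q N M = gauss_poly q (N - 1) M + q * x * gauss_poly q (N - 1) (M - 1)"
    using gauss_pascal[OF q, of N M] N by (simp add: pw)
  moreover have "gauss_poly q (N - 1) M = gauss_poly q (N - 2) M + x * gauss_poly q (N - 2) (M - 1)"
    using gauss_pascal[OF q, of "N - 1" M] N by (simp add: x_def)
  moreover have "gauss_poly q (N - 1) (M - 1)
      = gauss_poly q (N - 2) (M - 1) + q * x * gauss_poly q (N - 2) (M - 2)"
    using gauss_pascal[OF q, of "N - 1" "M - 1"] N by (simp add: pw)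
  ultimately show ?thesis
    unfolding sq by (simp add: algebra_simps)
qed

section \<open>The recurrence of the double sum\<close>

definition layer :: "nat \<Rightarrow> 'a::field \<Rightarrow> nat \<Rightarrow> 'a" where
  "layer n q j = (\<Sum>k\<le>j. P_summand n q j k)"

text \<open>
  The number \<open>M\<close> of layers is free because consecutive values of \<open>n\<close> have to be written as sums over
  the same range before they are compared layer by layer.
\<close>
lemma P_poly_layers:
  assumes "n \<le> M"
  shows "P_poly n q = (\<Sum>j\<le>M. layer n q j)"
proof -
  have z: "P_summand n q j k = 0" if "k > j \<or> j > M" for j k
    using that assms by (auto simp: P_summand_def gauss_poly_def)
  have "P_poly n q = sum (\<lambda>(j, k). P_summand n q j k) ({..M} \<times> {..M})"
    unfolding P_poly_def
  proof (rule Sum_any.expand_superset)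
    show "{a. (case a of (j, k) \<Rightarrow> P_summand n q j k) \<noteq> 0} \<subseteq> {..M} \<times> {..M}"
    proof clarify
      fix j k assume nz: "P_summand n q j k \<noteq> 0"
      then have "\<not> (k > j \<or> j > M)" using z by blast
      then show "j \<in> {..M} \<and> k \<in> {..M}" by auto
    qed
  qed simp
  also have "\<dots> = (\<Sum>j\<le>M. \<Sum>k\<le>M. P_summand n q j k)"
    by (simp add: sum.cartesian_product)
  also have "\<dots> = (\<Sum>j\<le>M. layer n q j)"
    unfolding layer_def by (intro sum.cong refl sum.mono_neutral_right) (auto simp: z)
  finally show ?thesis .
qed

text \<open>
  This is \<open>(-z;q\<^sup>2)\<^bsub>i+1\<^esub> = (1+z) (-zq\<^sup>2;q\<^sup>2)\<^sub>i\<close>, expanded by the \<open>q\<close>-binomial theorem and paired with an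
  arbitrary sequence \<open>g\<close> in place of the powers of \<open>z\<close>.
\<close>
lemma square_binomial_pascal:
  fixes g :: "nat \<Rightarrow> 'a::field"
  assumes q: "generic q"
  shows "(\<Sum>k\<le>Suc i. q ^ (k\<^sup>2 - k) * gauss_poly (q ^ 2) (int (Suc i)) (int k) * g k)
       = (\<Sum>k\<le>i. q ^ (k\<^sup>2 + k) * gauss_poly (q ^ 2) (int i) (int k) * (g k + g (Suc k)))"
proof -
  have q2: "generic (q ^ 2)" using q by (simp add: generic_power)
  have ps: "q ^ (k\<^sup>2 - k) * gauss_poly (q ^ 2) (int (Suc i)) (int k)
      = q ^ (k\<^sup>2 - k) * gauss_poly (q ^ 2) (int i) (int k - 1)
        + q ^ (k\<^sup>2 + k) * gauss_poly (q ^ 2) (int i) (int k)" for k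
  proof -
    have "k\<^sup>2 + k = (k\<^sup>2 - k) + 2 * k" by (cases k) (simp_all add: power2_eq_square)
    then have "q ^ (k\<^sup>2 + k) = q ^ (k\<^sup>2 - k) * (q ^ 2) ^ k"
      by (simp only: power_add power_mult)
    then show ?thesis
      using gauss_pascal'[OF q2, of "int (Suc i)" "int k"] by (simp add: algebra_simps)
  qed
  have "(\<Sum>k\<le>Suc i. q ^ (k\<^sup>2 - k) * gauss_poly (q ^ 2) (int (Suc i)) (int k) * g k)
      = (\<Sum>k\<le>Suc i. q ^ (k\<^sup>2 - k) * gauss_poly (q ^ 2) (int i) (int k - 1) * g k)
        + (\<Sum>k\<le>Suc i. q ^ (k\<^sup>2 + k) * gauss_poly (q ^ 2) (int i) (int k) * g k)"
    by (simp only: ps distrib_right sum.distrib)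
  also have "(\<Sum>k\<le>Suc i. q ^ (k\<^sup>2 - k) * gauss_poly (q ^ 2) (int i) (int k - 1) * g k)
      = (\<Sum>k\<le>i. q ^ (k\<^sup>2 + k) * gauss_poly (q ^ 2) (int i) (int k) * g (Suc k))"
    by (subst sum.atMost_Suc_shift)
       (simp add: gauss_outside power2_eq_square algebra_simps)
  also have "(\<Sum>k\<le>Suc i. q ^ (k\<^sup>2 + k) * gauss_poly (q ^ 2) (int i) (int k) * g k)
      = (\<Sum>k\<le>i. q ^ (k\<^sup>2 + k) * gauss_poly (q ^ 2) (int i) (int k) * g k)"
    by (simp add: gauss_outside)
  finally show ?thesis by (simp add: algebra_simps sum.distrib)
qed

lemma layer_second_difference:
  assumes q: "generic q"
  shows "layer (n + 2) q j - (1 + q) * layer (n + 1) q j + q * layer n q j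
       = (\<Sum>k\<le>j. q ^ (j\<^sup>2 + j + k\<^sup>2 + k) * gauss_poly (q ^ 2) (int j) (int k)
            * q powi (2 * (int n + 2 - int j - int k))
            * gauss_poly q (int n + 1 + int j - int k) (2 * int j - 1))"
proof -
  have "P_summand (n + 2) q j k - (1 + q) * P_summand (n + 1) q j k + q * P_summand n q j k
      = q ^ (j\<^sup>2 + j + k\<^sup>2 + k) * gauss_poly (q ^ 2) (int j) (int k)
            * q powi (2 * (int n + 2 - int j - int k))
            * gauss_poly q (int n + 1 + int j - int k) (2 * int j - 1)" (is "?L = ?R")
    if "k \<le> j" for k
  proof -
    define c where "c = q ^ (j\<^sup>2 + j + k\<^sup>2 + k) * gauss_poly (q ^ 2) (int j) (int k)"
    define N where "N = int n + int j - int k + 3"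
    define M where "M = 2 * int j + 1"
    have e: "int (n + 2) + int j - int k + 1 = N" "int (n + 1) + int j - int k + 1 = N - 1"
      "int n + int j - int k + 1 = N - 2" "int n + 1 + int j - int k = N - 2"
      "2 * int j - 1 = M - 2" "int n + 2 - int j - int k = N - M"
      by (simp_all add: N_def M_def)
    have "?L = c * (gauss_poly q N M - (1 + q) * gauss_poly q (N - 1) M + q * gauss_poly q (N - 2) M)"
      unfolding P_summand_def e c_def[symmetric] M_def[symmetric] by (simp add: algebra_simps)
    also have "\<dots> = ?R"
      unfolding e c_def[symmetric]
      by (subst gauss_second_difference) (use q that in \<open>auto simp: N_def\<close>)
    finally show ?thesis .
  qed
  then show ?thesis
    by (simp add: layer_def sum_distrib_left flip: sum_subtractf sum.distrib)
qed

text \<open>Here the lower index on the right-hand side of the second difference is \<open>2 * 0 - 1 < 0\<close>.\<close>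
lemma layer_0: "layer (n + 2) q 0 - (1 + q) * layer (n + 1) q 0 + q * layer n q 0 = 0"
  if "generic q"
  unfolding layer_second_difference[OF that] by (simp add: gauss_outside)

text \<open>
  The power of \<open>q\<close> in the second difference lowers \<open>k\<^sup>2 + k\<close> to \<open>k\<^sup>2 - k\<close>, which is the form in which
  \<open>square_binomial_pascal\<close> reduces the base-\<open>q\<^sup>2\<close> coefficients from \<open>Suc i\<close> to \<open>i\<close>. The two terms \<open>g k\<close> and
  \<open>g (Suc k)\<close> become two consecutive values of the previous layer.
\<close>
lemma layer_Suc:
  assumes q: "generic q"
  shows "layer (n + 2) q (Suc i) - (1 + q) * layer (n + 1) q (Suc i) + q * layer n q (Suc i)
       = q ^ (2 * (n + 2)) * (layer (n + 1) q i + layer n q i)"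
proof -
  have q0: "q \<noteq> 0" using q by (simp add: generic_def)
  define g where "g k = gauss_poly q (int n + 2 + int i - int k) (2 * int i + 1)" for k
  have pw: "q ^ ((Suc i)\<^sup>2 + Suc i + k\<^sup>2 + k) * q powi (2 * (int n + 2 - int (Suc i) - int k))
      = q ^ (2 * (n + 2)) * q ^ (i\<^sup>2 + i) * q ^ (k\<^sup>2 - k)" for k
  proof -
    define d where "d = k\<^sup>2 - k"
    have "k\<^sup>2 = k + d" by (simp add: d_def power2_eq_square)
    then have "int ((Suc i)\<^sup>2 + Suc i + k\<^sup>2 + k) + 2 * (int n + 2 - int (Suc i) - int k)
        = int (2 * (n + 2) + (i\<^sup>2 + i) + d)"
      by (simp add: power2_eq_square algebra_simps)
    then have "q powi (int ((Suc i)\<^sup>2 + Suc i + k\<^sup>2 + k) + 2 * (int n + 2 - int (Suc i) - int k))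
        = q powi int (2 * (n + 2) + (i\<^sup>2 + i) + (k\<^sup>2 - k))"
      by (simp only: d_def)
    then show ?thesis
      using q0 by (simp only: power_int_add power_int_of_nat power_add simp_thms)
  qed
  have "layer (n + 2) q (Suc i) - (1 + q) * layer (n + 1) q (Suc i) + q * layer n q (Suc i)
      = (\<Sum>k\<le>Suc i. (q ^ ((Suc i)\<^sup>2 + Suc i + k\<^sup>2 + k) * q powi (2 * (int n + 2 - int (Suc i) - int k)))
            * gauss_poly (q ^ 2) (int (Suc i)) (int k) * g k)"
    unfolding layer_second_difference[OF q] g_def by (intro sum.cong refl) (simp add: algebra_simps)
  also have "\<dots> = q ^ (2 * (n + 2)) * q ^ (i\<^sup>2 + i)
      * (\<Sum>k\<le>Suc i. q ^ (k\<^sup>2 - k) * gauss_poly (q ^ 2) (int (Suc i)) (int k) * g k)"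
    unfolding pw sum_distrib_left by (intro sum.cong refl) (simp only: mult_ac)
  also have "\<dots> = q ^ (2 * (n + 2)) * q ^ (i\<^sup>2 + i)
      * (\<Sum>k\<le>i. q ^ (k\<^sup>2 + k) * gauss_poly (q ^ 2) (int i) (int k) * (g k + g (Suc k)))"
    by (simp only: square_binomial_pascal[OF q])
  also have "\<dots> = q ^ (2 * (n + 2)) * (layer (n + 1) q i + layer n q i)"
    unfolding layer_def sum_distrib_left sum.distrib[symmetric]
    by (intro sum.cong refl) (simp add: P_summand_def g_def power_add algebra_simps)
  finally show ?thesis .
qed

lemma P_poly_rec:
  assumes q: "generic q"
  shows "P_poly (n + 2) q = (1 + q + q ^ (2 * (n + 2))) * P_poly (n + 1) q
                              + (q ^ (2 * (n + 2)) - q) * P_poly n q"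
proof -
  have "P_poly (n + 2) q - (1 + q) * P_poly (n + 1) q + q * P_poly n q
      = (\<Sum>j\<le>Suc (n + 1). layer (n + 2) q j - (1 + q) * layer (n + 1) q j + q * layer n q j)"
    by (simp add: P_poly_layers[of _ "Suc (n + 1)"] sum_distrib_left sum_subtractf sum.distrib
             del: sum.atMost_Suc)
  also have "\<dots> = (\<Sum>j\<le>n + 1. q ^ (2 * (n + 2)) * (layer (n + 1) q j + layer n q j))"
    by (subst sum.atMost_Suc_shift) (simp only: layer_0[OF q] layer_Suc[OF q] add_0)
  also have "\<dots> = q ^ (2 * (n + 2)) * (P_poly (n + 1) q + P_poly n q)"
    using P_poly_layers[of "n + 1" "n + 1" q] P_poly_layers[of n "n + 1" q]
    by (simp only: sum_distrib_left[symmetric] sum.distrib le_add1 order_refl simp_thms)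
  finally show ?thesis by (simp add: algebra_simps)
qed

lemma gauss_full: "gauss_poly q N N = 1" if "generic q" "N \<ge> 0"
  using gauss_symmetric[of q N N] that by simp

lemma P_poly_0: "P_poly 0 q = 1" if "generic q" 
  using that by (simp add: P_poly_layers[of 0 0] layer_def P_summand_def gauss_full generic_power)

lemma P_poly_1: "P_poly 1 q = q ^ 2 + q + 1" if "generic q"
proof -
  have "gauss_poly q 2 1 = 1 + q"
    using that gauss_pascal[of q 2 1] by (simp add: gauss_full)
  moreover have "generic (q * q)"
    using generic_power[OF that, of 2] by (simp add: power2_eq_square)
  ultimately show ?thesis
    using that by (simp add: P_poly_layers[of "Suc 0" "Suc 0"] layer_def P_summand_def gauss_full
      generic_power gauss_outside power2_eq_square)
qed

section \<open>The recurrence of the trinomial sum\<close>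

text \<open>
  Dividing by \<open>(p;p)\<^sub>L\<close> makes this an ordinary Cauchy product: if \<open>F(z) = \<Sum>\<^sub>m f(m) z\<^sup>m / (p;p)\<^sub>m\<close>, the convolution
  with \<open>f\<close> has the series \<open>F(z) / (xz;p)\<^sub>\<infinity>\<close>. The lemmas on \<open>gauss_conv\<close> translate operations on
  this product.
\<close>
definition gauss_conv :: "'a \<Rightarrow> 'a::field \<Rightarrow> nat \<Rightarrow> (nat \<Rightarrow> 'a) \<Rightarrow> 'a" where
  "gauss_conv x p L f = (\<Sum>r\<le>L. x ^ r * gauss_poly p (int L) (int r) * f (L - r))"

lemma gauss_conv_add:
  "gauss_conv x p L (\<lambda>m. f m + g m) = gauss_conv x p L f + gauss_conv x p L g"
  by (simp add: gauss_conv_def distrib_left sum.distrib)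

lemma gauss_conv_scale: "gauss_conv x p L (\<lambda>m. c * f m) = c * gauss_conv x p L f"
  by (simp add: gauss_conv_def sum_distrib_left mult_ac)

text \<open>
  Raising \<open>L\<close> commutes with the convolution up to the extra term \<open>x * p ^ m * f m\<close>, the product rule for the
  difference operator \<open>F(z) \<mapsto> (F(z) - F(pz)) / z\<close>.
\<close>
lemma gauss_conv_Suc:
  assumes p: "generic p"
  shows "gauss_conv x p (Suc L) f = gauss_conv x p L (\<lambda>m. f (Suc m) + x * p ^ m * f m)"
proof -
  have ps: "x ^ r * gauss_poly p (int (Suc L)) (int r) * f (Suc L - r)
      = x ^ r * gauss_poly p (int L) (int r) * f (Suc L - r)
        + x ^ r * p ^ (Suc L - r) * gauss_poly p (int L) (int r - 1) * f (Suc L - r)"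
    if "r \<le> Suc L" for r
  proof -
    have "p powi (int (Suc L) - int r) = p ^ (Suc L - r)"
      using that by (simp only: power_int_of_nat flip: of_nat_diff)
    then show ?thesis
      using gauss_pascal[OF p, of "int (Suc L)" "int r"] by (simp add: algebra_simps)
  qed
  have "gauss_conv x p (Suc L) f
      = (\<Sum>r\<le>Suc L. x ^ r * gauss_poly p (int L) (int r) * f (Suc L - r))
        + (\<Sum>r\<le>Suc L. x ^ r * p ^ (Suc L - r) * gauss_poly p (int L) (int r - 1) * f (Suc L - r))"
    unfolding gauss_conv_def sum.distrib[symmetric] by (intro sum.cong refl ps) simp
  also have "(\<Sum>r\<le>Suc L. x ^ r * gauss_poly p (int L) (int r) * f (Suc L - r))
      = gauss_conv x p L (\<lambda>m. f (Suc m))"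
    unfolding gauss_conv_def by (simp add: gauss_outside Suc_diff_le)
  also have "(\<Sum>r\<le>Suc L. x ^ r * p ^ (Suc L - r) * gauss_poly p (int L) (int r - 1) * f (Suc L - r))
      = gauss_conv x p L (\<lambda>m. x * p ^ m * f m)"
    unfolding gauss_conv_def
    by (subst sum.atMost_Suc_shift) (simp add: gauss_outside algebra_simps)
  finally show ?thesis by (simp add: gauss_conv_add)
qed

text \<open>
  In terms of series, \<open>1 / (xpz;p)\<^sub>\<infinity> = (1 - xz) / (xz;p)\<^sub>\<infinity>\<close>, and multiplication of a series by \<open>z\<close> takes
  the sequence \<open>g m\<close> to \<open>(1 - p ^ m) * g (m - 1)\<close>. At \<open>m = 0\<close> the truncated \<open>m - 1\<close> is harmless because
  of the factor \<open>1 - p ^ 0\<close>.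
\<close>
lemma gauss_conv_dilate:
  assumes p: "generic p"
  shows "gauss_conv (x * p) p L g = gauss_conv x p L (\<lambda>m. g m - x * (1 - p ^ m) * g (m - 1))"
proof -
  define h where "h r = x ^ r * ((1 - p ^ r) * gauss_poly p (int L) (int r)) * g (L - r)" for r
  have h: "h (Suc r) = x ^ r * gauss_poly p (int L) (int r) * (x * (1 - p ^ (L - r)) * g (L - r - 1))"
    if "r < L" for r
  proof -
    have "p powi (int L - int (Suc r) + 1) = p ^ (L - r)"
      using that by (simp flip: of_nat_diff)
    moreover have "int (Suc r) - 1 = int r" by simp
    ultimately have ab: "(1 - p ^ Suc r) * gauss_poly p (int L) (int (Suc r))
        = (1 - p ^ (L - r)) * gauss_poly p (int L) (int r)"
      using gauss_absorb[OF p, of "int L" "int (Suc r)"]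
      by (simp only: power_int_of_nat of_nat_0_le_iff simp_thms)
    show ?thesis unfolding h_def ab by simp
  qed
  have "gauss_conv (x * p) p L g = gauss_conv x p L g - (\<Sum>r\<le>L. h r)"
    unfolding gauss_conv_def h_def sum_subtractf[symmetric]
    by (intro sum.cong refl) (simp add: power_mult_distrib algebra_simps)
  also have "(\<Sum>r\<le>L. h r) = (\<Sum>r<L. h (Suc r))"
  proof (cases L)
    case (Suc l)
    then show ?thesis
      by (simp add: sum.atMost_Suc_shift lessThan_Suc_atMost h_def del: sum.atMost_Suc)
  qed (simp add: h_def)
  also have "\<dots> = (\<Sum>r<L. x ^ r * gauss_poly p (int L) (int r) * (x * (1 - p ^ (L - r)) * g (L - r - 1)))"
    by (intro sum.cong refl h) simp
  also have "\<dots> = gauss_conv x p L (\<lambda>m. x * (1 - p ^ m) * g (m - 1))"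
    unfolding gauss_conv_def by (simp flip: lessThan_Suc_atMost)
  finally show ?thesis
    by (simp add: gauss_conv_def right_diff_distrib sum_subtractf)
qed

text \<open>Since \<open>y\<^sup>r y\<^bsup>L-r\<^esup> = y\<^sup>L\<close>, this trades \<open>T\<^sub>1\<close> for \<open>T\<^sub>0\<close> at the price of a power of \<open>y = q\<close>.\<close>
lemma gauss_conv_power:
  "gauss_conv (x * y) p L (\<lambda>m. y ^ m * f m) = y ^ L * gauss_conv x p L f"
proof -
  have "(x * y) ^ r * y ^ (L - r) = y ^ L * x ^ r" if "r \<le> L" for r
  proof -
    have "y ^ L = y ^ r * y ^ (L - r)" using that by (simp flip: power_add)
    then show ?thesis by (simp add: power_mult_distrib)
  qed
  note powers = this
  have "(x * y) ^ r * gauss_poly p (int L) (int r) * (y ^ (L - r) * f (L - r))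
      = y ^ L * (x ^ r * gauss_poly p (int L) (int r) * f (L - r))" if "r \<le> L" for r
  proof -
    have "(x * y) ^ r * gauss_poly p (int L) (int r) * (y ^ (L - r) * f (L - r))
        = ((x * y) ^ r * y ^ (L - r)) * (gauss_poly p (int L) (int r) * f (L - r))"
      by (simp only: mult_ac)
    then show ?thesis
      unfolding powers[OF that] by (simp only: mult_ac)
  qed
  then show ?thesis
    unfolding gauss_conv_def sum_distrib_left by (intro sum.cong) auto
qed

definition central :: "'a::field \<Rightarrow> int \<Rightarrow> nat \<Rightarrow> 'a" where
  "central q A m = gauss_poly q (2 * int m) (int m - A)"

definition T0 :: "nat \<Rightarrow> int \<Rightarrow> 'a::field \<Rightarrow> 'a" where
  "T0 L A q = gauss_conv (- 1) (q ^ 2) L (central q A)"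

lemma T1_conv: "T1 L A q = gauss_conv (- q) (q ^ 2) L (central q A)"
  unfolding T1_def gauss_conv_def central_def atLeast0AtMost
  by (intro sum.cong refl) (auto simp: of_nat_diff algebra_simps)

lemma central_symmetric: "central q (- A) m = central q A m"
  using gauss_symmetric[of q "2 * int m" "int m - A"] by (simp add: central_def)

lemma T0_symmetric: "T0 L (- A) q = T0 L A q" and T1_symmetric: "T1 L (- A) q = T1 L A q"
  by (simp_all add: T0_def T1_conv gauss_conv_def central_symmetric)

text \<open>
  Two steps of Pascal's rule, mixing its two forms so that the result is symmetric under \<open>A \<mapsto> -A\<close>.
\<close>
lemma central_Suc:
  assumes q: "generic q"
  shows "central q A (Suc m) = (1 + q ^ (2 * m + 1)) * central q A m
           + q powi (int m + 1 + A) * central q (A + 1) m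
           + q powi (int m + 1 - A) * central q (A - 1) m"
proof -
  define K where "K = int m - A"
  have c: "central q A (Suc m) = gauss_poly q (2 * int m + 2) (K + 1)"
    "central q A m = gauss_poly q (2 * int m) K"
    "central q (A + 1) m = gauss_poly q (2 * int m) (K - 1)"
    "central q (A - 1) m = gauss_poly q (2 * int m) (K + 1)"
    by (simp_all add: central_def K_def algebra_simps)
  have "int m + 1 - A = K + 1" "int m + 1 + A = 2 * int m + 1 - K" by (simp_all add: K_def)
  note e = this
  have "q powi (K + 1) * q powi (2 * int m - K) = q powi int (2 * m + 1)"
    using q by (simp add: generic_def add.commute flip: power_int_add)
  then have pw: "q powi (K + 1) * q powi (2 * int m - K) = q ^ (2 * m + 1)"
    by (simp only: power_int_of_nat)
  have 1: "gauss_poly q (2 * int m + 2) (K + 1)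
      = gauss_poly q (2 * int m + 1) K + q powi (K + 1) * gauss_poly q (2 * int m + 1) (K + 1)"
    using gauss_pascal'[OF q, of "2 * int m + 2" "K + 1"] by (simp add: add.commute)
  have 2: "gauss_poly q (2 * int m + 1) K
      = gauss_poly q (2 * int m) K + q powi (2 * int m + 1 - K) * gauss_poly q (2 * int m) (K - 1)"
    using gauss_pascal[OF q, of "2 * int m + 1" K] by simp
  have 3: "gauss_poly q (2 * int m + 1) (K + 1)
      = gauss_poly q (2 * int m) (K + 1) + q powi (2 * int m - K) * gauss_poly q (2 * int m) K"
    using gauss_pascal[OF q, of "2 * int m + 1" "K + 1"] by simp
  show ?thesis
    unfolding c e 1 2 3 pw[symmetric] by (simp add: algebra_simps)
qed

text \<open>
  The extra term of \<open>gauss_conv_Suc\<close> is \<open>- q ^ (2 * m + 1) * central q A m\<close>, which cancels one of the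
  terms of \<open>central_Suc\<close>. In the other two, the factor \<open>q ^ m\<close> converts the weight \<open>(-q)\<^sup>r\<close> into
  \<open>q\<^sup>L (-1)\<^sup>r\<close>.
\<close>
lemma T1_Suc:
  assumes q: "generic q"
  shows "T1 (Suc L) A q = T1 L A q + q powi (int L + 1 + A) * T0 L (A + 1) q
                                   + q powi (int L + 1 - A) * T0 L (A - 1) q"
proof -
  have q0: "q \<noteq> 0" using q by (simp add: generic_def)
  have shift: "q powi (int m + 1 + B) = q powi (1 + B) * q ^ m" for m B
    using power_int_add[of q "1 + B" "int m"] q0 by (simp add: algebra_simps)
  have pt: "central q A (Suc m) + - q * (q ^ 2) ^ m * central q A m
      = (central q A m + q powi (1 + A) * (q ^ m * central q (A + 1) m))
         + q powi (1 - A) * (q ^ m * central q (A - 1) m)" for m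
    using shift[of m A] shift[of m "- A"]
    by (simp add: central_Suc[OF q] algebra_simps flip: power_mult)
  have pw: "gauss_conv (- q) (q ^ 2) L (\<lambda>m. q ^ m * central q B m) = q ^ L * T0 L B q" for B
    using gauss_conv_power[of "- 1" q "q ^ 2" L] by (simp add: T0_def)
  have "T1 (Suc L) A q = T1 L A q + q powi (1 + A) * (q ^ L * T0 L (A + 1) q)
                                   + q powi (1 - A) * (q ^ L * T0 L (A - 1) q)"
    unfolding T1_conv gauss_conv_Suc[OF generic_power[OF q zero_less_numeral]] pt
      gauss_conv_add gauss_conv_scale pw ..
  then show ?thesis
    using shift[of L A] shift[of L "- A"] by simp
qed

text \<open>
  This is \<open>T0_Suc\<close> before convolution. The function \<open>g\<close> is chosen so that \<open>q\<close> times its convolution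
  with \<open>(-q\<^sup>2)\<^sup>r\<close> gives the two terms of \<open>T0_Suc\<close> that carry powers of \<open>q\<^sup>L\<close>; the terms \<open>g m\<close> and \<open>g (m - 1)\<close>
  come from \<open>gauss_conv_dilate\<close>. By Pascal's rule \<open>g A m\<close> is a multiple of the single coefficient
  \<open>[2m+1; m-A+1]\<close>, and then the identity is one between multiples of Gaussian coefficients.
\<close>
lemma central_Suc_dilate:
  assumes q: "generic q"
  defines "g \<equiv> \<lambda>A m. q powi (int m - A) * central q (A - 1) m + q ^ (2 * m) * central q A m"
  shows "central q A (Suc m) - q ^ (2 * m) * central q A m
       = central q (A + 1) m + q * (g A m + (1 - q ^ (2 * m)) * g A (m - 1))"
proof -
  have q0: "q \<noteq> 0" using q by (simp add: generic_def)
  have g: "g A m = q powi (int m - A) * gauss_poly q (2 * int m + 1) (int m - A + 1)" for m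
  proof -
    have "q powi (int m - A) * q powi (int m + A) = q powi (int (2 * m))"
      using q0 by (simp flip: power_int_add)
    then have "q powi (int m - A) * q powi (int m + A) = q ^ (2 * m)"
      by (simp only: power_int_of_nat)
    then show ?thesis
      using gauss_pascal[OF q, of "2 * int m + 1" "int m - A + 1"]
      by (simp add: g_def central_def algebra_simps)
  qed
  define K where "K = int m - A"
  define x where "x = q powi K"
  have c: "central q A (Suc m) = gauss_poly q (2 * int m + 2) (K + 1)"
    "central q A m = gauss_poly q (2 * int m) K"
    "central q (A + 1) m = gauss_poly q (2 * int m) (K - 1)"
    by (simp_all add: central_def K_def algebra_simps)
  have x: "q powi (K + 1) = q * x" using power_int_add_1'[of q K] q0 by (simp add: x_def)
  have 1: "gauss_poly q (2 * int m + 2) (K + 1)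
      = gauss_poly q (2 * int m + 1) K + q * x * gauss_poly q (2 * int m + 1) (K + 1)"
    using gauss_pascal'[OF q, of "2 * int m + 2" "K + 1"] unfolding x by (simp add: add.commute)
  have 2: "gauss_poly q (2 * int m + 1) K
      = gauss_poly q (2 * int m) (K - 1) + x * gauss_poly q (2 * int m) K"
    using gauss_pascal'[OF q, of "2 * int m + 1" K] by (simp add: x_def)
  have 3: "(x - q ^ (2 * m)) * gauss_poly q (2 * int m) K
      = x * ((1 - q ^ (2 * m)) * gauss_poly q (2 * int m - 1) K)"
  proof -
    have "x * q powi (2 * int m - K) = q powi int (2 * m)"
      using q0 by (simp add: x_def flip: power_int_add)
    then have "x * q powi (2 * int m - K) = q ^ (2 * m)"
      by (simp only: power_int_of_nat)
    then have "(x - q ^ (2 * m)) = x * (1 - q powi (2 * int m - K))"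
      by (simp add: algebra_simps)
    moreover have "q powi (2 * int m) = q ^ (2 * m)"
      using power_int_of_nat[of q "2 * m"] by simp
    ultimately show ?thesis
      using gauss_lower_top[OF q, of "2 * int m" K] by simp
  qed
  have 4: "q * ((1 - q ^ (2 * m)) * g A (m - 1))
      = x * ((1 - q ^ (2 * m)) * gauss_poly q (2 * int m - 1) K)"
  proof (cases m)
    case (Suc l)
    have "q * q powi (int l - A) = x"
      using power_int_add_1'[of q "int l - A"] q0 by (simp add: x_def K_def Suc algebra_simps)
    then have "q * g A (m - 1) = x * gauss_poly q (2 * int l + 1) (int l - A + 1)"
      unfolding g by (simp add: Suc flip: mult.assoc)
    moreover have "2 * int l + 1 = 2 * int m - 1" "int l - A + 1 = K"
      by (simp_all add: Suc K_def)
    ultimately have "q * g A (m - 1) = x * gauss_poly q (2 * int m - 1) K" by (simp only:)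
    then have "(1 - q ^ (2 * m)) * (q * g A (m - 1))
        = (1 - q ^ (2 * m)) * (x * gauss_poly q (2 * int m - 1) K)" by (simp only:)
    then show ?thesis by (simp only: mult.left_commute)
  qed simp
  have 5: "q * g A m = q * x * gauss_poly q (2 * int m + 1) (K + 1)"
    by (simp add: g x_def K_def)
  show ?thesis
    unfolding c distrib_left[of q] 4 5 3[symmetric] 1 2 by (simp add: algebra_simps)
qed

lemma T0_Suc:
  assumes q: "generic q"
  shows "T0 (Suc L) A q = T0 L (A + 1) q + q powi (int L + 1 - A) * T1 L (A - 1) q
                            + q ^ (2 * L + 1) * T0 L A q"
proof -
  have q0: "q \<noteq> 0" using q by (simp add: generic_def)
  have q2: "generic (q ^ 2)" using q by (simp add: generic_power)
  define g where "g m = q powi (int m - A) * central q (A - 1) m + q ^ (2 * m) * central q A m" for m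
  have "T0 (Suc L) A q
      = gauss_conv (- 1) (q ^ 2) L (\<lambda>m. central q (A + 1) m
          + q * (g m - (- 1) * (1 - (q ^ 2) ^ m) * g (m - 1)))"
    unfolding T0_def gauss_conv_Suc[OF q2]
  proof (intro arg_cong[of _ _ "gauss_conv (- 1) (q ^ 2) L"] ext)
    fix m
    have "central q A (Suc m) - q ^ (2 * m) * central q A m
        = central q (A + 1) m + q * (g m + (1 - q ^ (2 * m)) * g (m - 1))"
      unfolding g_def by (rule central_Suc_dilate[OF q])
    then show "central q A (Suc m) + - 1 * (q ^ 2) ^ m * central q A m
        = central q (A + 1) m + q * (g m - (- 1) * (1 - (q ^ 2) ^ m) * g (m - 1))"
      unfolding power_mult by (simp only: mult_minus_left mult_1_left diff_minus_eq_add
          add_uminus_conv_diff)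
  qed
  also have "\<dots> = T0 L (A + 1) q + q * gauss_conv (- 1 * q ^ 2) (q ^ 2) L g"
    unfolding gauss_conv_add gauss_conv_scale T0_def gauss_conv_dilate[OF q2] ..
  also have "q * gauss_conv (- 1 * q ^ 2) (q ^ 2) L g
      = q powi (int L + 1 - A) * T1 L (A - 1) q + q ^ (2 * L + 1) * T0 L A q"
  proof -
    have "g = (\<lambda>m. q powi (- A) * (q ^ m * central q (A - 1) m) + (q ^ 2) ^ m * central q A m)"
    proof
      fix m
      have "q powi (int m - A) = q powi (- A) * q ^ m"
        using power_int_add[of q "- A" "int m"] q0 by simp
      then show "g m = q powi (- A) * (q ^ m * central q (A - 1) m) + (q ^ 2) ^ m * central q A m"
        by (simp add: g_def flip: power_mult)
    qed
    moreover have "gauss_conv (- 1 * q ^ 2) (q ^ 2) L (\<lambda>m. q ^ m * central q (A - 1) m)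
        = q ^ L * T1 L (A - 1) q"
      using gauss_conv_power[of "- q" q "q ^ 2" L]
      by (simp add: T1_conv power2_eq_square)
    moreover have "gauss_conv (- 1 * q ^ 2) (q ^ 2) L (\<lambda>m. (q ^ 2) ^ m * central q A m)
        = q ^ (2 * L) * T0 L A q"
      unfolding gauss_conv_power T0_def by (simp add: power_mult)
    moreover have "q powi (int L + 1 - A) = q * q powi (- A) * q ^ L"
      using power_int_add[of q "- A" "int (Suc L)"] q0
      by (simp add: algebra_simps del: power_int_of_nat) (simp add: power_int_add)
    ultimately show ?thesis
      by (simp only: gauss_conv_add gauss_conv_scale) (simp add: algebra_simps)
  qed
  finally show ?thesis by (simp add: add.assoc)
qed

text \<open>
  The mirror image of \<open>T0_Suc\<close>. The first form is used for \<open>A = 3j + 2\<close> and the second for \<open>A = 3j\<close>: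
  in both cases the \<open>T\<^sub>1\<close> on the right then has the argument \<open>3j + 1\<close>.
\<close>
lemma T0_Suc':
  assumes q: "generic q"
  shows "T0 (Suc L) A q = T0 L (A - 1) q + q powi (int L + 1 + A) * T1 L (A + 1) q
                            + q ^ (2 * L + 1) * T0 L A q"
  using T0_Suc[OF q, of L "- A"] T0_symmetric[of L A q] T0_symmetric[of "Suc L" A q]
    T0_symmetric[of L "A - 1" q] T1_symmetric[of L "A + 1" q]
  by (simp add: algebra_simps)

section \<open>Summation over a residue class modulo three\<close>

text \<open>
  The exponents of \<open>v_term\<close> and \<open>w_term\<close> are forced by \<open>T1_Suc\<close>: they are what remains of
  \<open>3j\<^sup>2 + 2j + (L + 1 \<plusminus> (3j + 1))\<close> once \<open>L\<close> is split off.
\<close>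
definition u_term :: "nat \<Rightarrow> 'a::field \<Rightarrow> int \<Rightarrow> 'a" where
  "u_term L q j = q powi (3 * j\<^sup>2 + 2 * j) * T1 L (3 * j + 1) q"

definition v_term :: "nat \<Rightarrow> 'a::field \<Rightarrow> int \<Rightarrow> 'a" where
  "v_term L q j = q powi (3 * j\<^sup>2 + 5 * j + 2) * T0 L (3 * j + 2) q"

definition w_term :: "nat \<Rightarrow> 'a::field \<Rightarrow> int \<Rightarrow> 'a" where
  "w_term L q j = q powi (3 * j\<^sup>2 - j) * T0 L (3 * j) q"

lemma T0_eq_0: "T0 L A q = 0" if "\<bar>A\<bar> > int L"
  unfolding T0_def gauss_conv_def central_def gauss_poly_def using that
  by (intro sum.neutral) auto

lemma finite_v_term: "finite {j. v_term L q j \<noteq> 0}"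
  and finite_w_term: "finite {j. w_term L q j \<noteq> 0}"
proof -
  have "\<bar>3 * j + 2\<bar> \<le> int L" if "v_term L q j \<noteq> 0" for j
    using that T0_eq_0[of L "3 * j + 2" q] by (force simp: v_term_def)
  then have "{j. v_term L q j \<noteq> 0} \<subseteq> {- int L - 2..int L + 2}" by force
  then show "finite {j. v_term L q j \<noteq> 0}" by (rule finite_subset) simp
  have "\<bar>3 * j\<bar> \<le> int L" if "w_term L q j \<noteq> 0" for j
    using that T0_eq_0[of L "3 * j" q] by (force simp: w_term_def)
  then have "{j. w_term L q j \<noteq> 0} \<subseteq> {- int L..int L}" by force
  then show "finite {j. w_term L q j \<noteq> 0}" by (rule finite_subset) simp
qed

lemma finite_u_term: "finite {j. u_term L q j \<noteq> 0}"
  unfolding u_term_def by (rule finite_T1_support)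

lemma Sum_any_linear3:
  fixes f g h :: "'b \<Rightarrow> 'a::field"
  assumes "finite {j. f j \<noteq> 0}" "finite {j. g j \<noteq> 0}" "finite {j. h j \<noteq> 0}"
  shows "Sum_any (\<lambda>j. f j + c * g j + d * h j) = Sum_any f + c * Sum_any g + d * Sum_any h"
proof -
  have fin: "finite {j. c * g j \<noteq> 0}" "finite {j. d * h j \<noteq> 0}"
    by (rule finite_subset[OF _ assms(2)], force) (rule finite_subset[OF _ assms(3)], force)
  have "finite {j. f j + c * g j \<noteq> 0}"
    by (rule finite_subset[OF _ finite_UnI[OF assms(1) fin(1)]]) auto
  then show ?thesis
    using assms fin by (simp add: Sum_any.distrib Sum_any_right_distrib)
qed

lemma Sum_any_shift: "Sum_any (\<lambda>j. f (j + c)) = Sum_any f" for c :: int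
  by (rule Sum_any.reindex_cong[of "\<lambda>j. j + c", symmetric])
     (auto simp: bij_plus_right comp_def)

lemma finite_shift: "finite {j. f (j + c) \<noteq> 0}" if "finite {j. f j \<noteq> 0}" for c :: int
proof -
  have "{j. f (j + c) \<noteq> 0} = (\<lambda>j. j - c) ` {j. f j \<noteq> 0}"
    by (force simp: image_iff intro: exI[of _ "_ + c"])
  then show ?thesis using that by simp
qed

lemma u_term_Suc:
  assumes q: "generic q"
  shows "u_term (Suc L) q j = u_term L q j + q ^ L * v_term L q j + q ^ L * w_term L q j"
proof -
  have q0: "q \<noteq> 0" using q by (simp add: generic_def)
  have "q powi (3 * j\<^sup>2 + 2 * j) * q powi (int L + 1 + (3 * j + 1))
      = q powi int L * q powi (3 * j\<^sup>2 + 5 * j + 2)"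
    and "q powi (3 * j\<^sup>2 + 2 * j) * q powi (int L + 1 - (3 * j + 1))
      = q powi int L * q powi (3 * j\<^sup>2 - j)"
    using q0 by (simp_all add: algebra_simps flip: power_int_add del: power_int_of_nat)
  moreover have "3 * j + 1 + 1 = 3 * j + 2" "3 * j + 1 - 1 = 3 * j" by simp_all
  ultimately show ?thesis
    unfolding u_term_def v_term_def w_term_def T1_Suc[OF q] power_int_of_nat
    by (simp only: distrib_left mult.assoc[symmetric])
qed

text \<open>
  The step closes up because \<open>3j\<^sup>2 + 5j + 2 = 3(j+1)\<^sup>2 - (j+1)\<close>, so that the term with
  \<open>T\<^sub>0(L, 3(j+1))\<close> already carries the weight of \<open>w_term\<close>.
\<close>
lemma v_term_Suc:
  assumes q: "generic q"
  shows "v_term (Suc L) q j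
       = w_term L q (j + 1) + q ^ (L + 1) * u_term L q j + q ^ (2 * L + 1) * v_term L q j"
proof -
  have q0: "q \<noteq> 0" using q by (simp add: generic_def)
  have "q powi (3 * j\<^sup>2 + 5 * j + 2) * q powi (int L + 1 - (3 * j + 2))
      = q powi int (L + 1) * q powi (3 * j\<^sup>2 + 2 * j)"
    using q0 by (simp add: algebra_simps flip: power_int_add del: power_int_of_nat)
  moreover have "3 * (j + 1)\<^sup>2 - (j + 1) = 3 * j\<^sup>2 + 5 * j + 2" "3 * (j + 1) = 3 * j + 2 + 1"
    "3 * j + 2 - 1 = 3 * j + 1"
    by (simp_all add: power2_eq_square algebra_simps)
  ultimately show ?thesis
    unfolding u_term_def v_term_def w_term_def T0_Suc[OF q] power_int_of_nat
    by (simp only: distrib_left mult.assoc[symmetric]) (simp only: mult_ac)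
qed

lemma w_term_Suc:
  assumes q: "generic q"
  shows "w_term (Suc L) q j
       = v_term L q (j + - 1) + q ^ (L + 1) * u_term L q j + q ^ (2 * L + 1) * w_term L q j"
proof -
  have q0: "q \<noteq> 0" using q by (simp add: generic_def)
  have "q powi (3 * j\<^sup>2 - j) * q powi (int L + 1 + 3 * j)
      = q powi int (L + 1) * q powi (3 * j\<^sup>2 + 2 * j)"
    using q0 by (simp add: algebra_simps flip: power_int_add del: power_int_of_nat)
  moreover have "3 * (j + - 1)\<^sup>2 + 5 * (j + - 1) + 2 = 3 * j\<^sup>2 - j" "3 * (j + - 1) + 2 = 3 * j - 1"
    by (simp_all add: power2_eq_square algebra_simps)
  ultimately show ?thesis
    unfolding u_term_def v_term_def w_term_def T0_Suc'[OF q] power_int_of_nat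
    by (simp only: distrib_left mult.assoc[symmetric]) (simp only: mult_ac)
qed

lemma Sum_any_u_term_Suc:
  assumes q: "generic q"
  shows "Sum_any (u_term (Suc L) q)
       = Sum_any (u_term L q) + q ^ L * (Sum_any (v_term L q) + Sum_any (w_term L q))"
  unfolding u_term_Suc[OF q, abs_def]
  by (subst Sum_any_linear3)
     (simp_all only: finite_u_term finite_v_term finite_w_term distrib_left add.assoc)

lemma Sum_any_v_w_term_Suc:
  assumes q: "generic q"
  shows "Sum_any (v_term (Suc L) q) + Sum_any (w_term (Suc L) q)
       = (1 + q ^ (2 * L + 1)) * (Sum_any (v_term L q) + Sum_any (w_term L q))
         + 2 * q ^ (L + 1) * Sum_any (u_term L q)"
proof -
  have "Sum_any (v_term (Suc L) q) = Sum_any (w_term L q)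
      + q ^ (L + 1) * Sum_any (u_term L q) + q ^ (2 * L + 1) * Sum_any (v_term L q)"
    unfolding v_term_Suc[OF q, abs_def]
    by (subst Sum_any_linear3)
       (simp_all only: finite_u_term finite_v_term finite_shift finite_w_term Sum_any_shift)
  moreover have "Sum_any (w_term (Suc L) q) = Sum_any (v_term L q)
      + q ^ (L + 1) * Sum_any (u_term L q) + q ^ (2 * L + 1) * Sum_any (w_term L q)"
    unfolding w_term_Suc[OF q, abs_def]
    by (subst Sum_any_linear3)
       (simp_all only: finite_u_term finite_v_term finite_shift finite_w_term Sum_any_shift)
  ultimately show ?thesis by (simp add: algebra_simps)
qed

text \<open>
  Eliminating \<open>Y\<close>: \<open>U\<^bsub>L+2\<^esub> - U\<^bsub>L+1\<^esub> = q\<^bsup>L+1\<^esup> Y\<^bsub>L+1\<^esub> = q (1 + q\<^bsup>2L+1\<^esup>) (U\<^bsub>L+1\<^esub> - U\<^sub>L) + 2q\<^bsup>2L+2\<^esup> U\<^sub>L\<close>.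
\<close>
lemma Sum_any_u_term_rec:
  assumes q: "generic q"
  shows "Sum_any (u_term (L + 2) q) = (1 + q + q ^ (2 * (L + 1))) * Sum_any (u_term (L + 1) q)
           + (q ^ (2 * (L + 1)) - q) * Sum_any (u_term L q)"
proof -
  define U where "U = Sum_any (u_term L q)"
  define Y where "Y = Sum_any (v_term L q) + Sum_any (w_term L q)"
  have 1: "Sum_any (u_term (Suc L) q) = U + q ^ L * Y"
    by (simp add: Sum_any_u_term_Suc[OF q] U_def Y_def)
  have "Sum_any (u_term (Suc (Suc L)) q)
      = (U + q ^ L * Y) + q ^ Suc L * ((1 + q ^ (2 * L + 1)) * Y + 2 * q ^ (L + 1) * U)"
    unfolding Sum_any_u_term_Suc[OF q, of "Suc L"] Sum_any_v_w_term_Suc[OF q] 1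
    by (simp only: U_def Y_def)
  moreover have "(U + q ^ L * Y) + q ^ Suc L * ((1 + q ^ (2 * L + 1)) * Y + 2 * q ^ (L + 1) * U)
      = (1 + q + q ^ (2 * (L + 1))) * (U + q ^ L * Y) + (q ^ (2 * (L + 1)) - q) * U"
  proof -
    have "q ^ (2 * (L + 1)) = q * q * (q ^ L * q ^ L)" "q ^ (2 * L + 1) = q * (q ^ L * q ^ L)"
      "q ^ Suc L = q * q ^ L" "q ^ (L + 1) = q * q ^ L"
      by (simp_all add: mult_2 power_add)
    then show ?thesis by (simp only:) (simp add: algebra_simps)
  qed
  moreover have "L + 2 = Suc (Suc L)" "L + 1 = Suc L" by simp_all
  ultimately show ?thesis
    by (simp only: 1 U_def[symmetric])
qed

text \<open>
  Starting from the empty level \<open>0\<close> makes the value \<open>1 + q + q\<^sup>2\<close> at level \<open>2\<close> an instance of the recurrence.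
\<close>
lemma Sum_any_u_term_0: "Sum_any (u_term 0 q) = 0"
proof -
  have "u_term 0 q j = 0" for j
    unfolding u_term_def by (subst T1_eq_0) (auto, presburger)
  then show ?thesis by simp
qed

lemma Sum_any_u_term_1: "Sum_any (u_term 1 q) = 1" if "generic q"
proof -
  have "T1 1 1 q = 1"
    using that by (simp add: T1_def gauss_outside generic_power)
  moreover have "\<bar>3 * j + 1\<bar> > int 1" if "j \<noteq> 0" for j :: int
    using that by auto
  ultimately have "u_term 1 q = (\<lambda>j. if j = 0 then 1 else 0)"
    using T1_eq_0[of 1 _ q] by (force simp: u_term_def)
  then show ?thesis by simp
qed

lemma P_poly_eq_trinomial_sum:
  assumes q: "generic q"
  shows "P_poly n q = Sum_any (u_term (n + 1) q)"
proof (induction n rule: induct_nat_012)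
  case 0
  then show ?case using q Sum_any_u_term_1 by (simp add: P_poly_0)
next
  case 1
  then show ?case
    using P_poly_1[OF q] Sum_any_u_term_rec[OF q, of 0] Sum_any_u_term_1[OF q]
      Sum_any_u_term_0[of q]
    by (simp add: numeral_2_eq_2)
next
  case (ge2 n)
  then show ?case
    using P_poly_rec[OF q, of n] Sum_any_u_term_rec[OF q, of "n + 1"]
    by (simp add: numeral_2_eq_2)
qed

text \<open>The powers of the indeterminate are distinct monomials, distinguished from \<open>1\<close> by their degree.\<close>
lemma generic_qvar: "generic qvar"
proof -
  have pow: "qvar ^ n = Fract (monom 1 n) 1" for n
    by (induction n) (auto simp: qvar_def One_fract_def monom_Suc mult_fract[symmetric] simp flip: one_pCons)
  have "qvar ^ n \<noteq> 1" if "n > 0" for n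
  proof
    assume "qvar ^ n = 1"
    then have "monom 1 n = (1 :: int poly)" by (simp add: pow One_fract_def eq_fract)
    then have "degree (monom (1 :: int) n) = 0" by simp
    then show False using that by (simp add: degree_monom_eq)
  qed
  moreover have "qvar \<noteq> 0" by (simp add: qvar_def Zero_fract_def eq_fract)
  ultimately show ?thesis by (simp add: generic_def)
qed

theorem mainTheorem8:
  shows "(\<forall>n::nat. P_poly n qvar =
            Sum_any (\<lambda>j::int. qvar powi (3 * j\<^sup>2 + 2 * j) * T1 (n + 1) (3 * j + 1) qvar))
       \<and> P_poly 0 qvar = 1
       \<and> P_poly 1 qvar = qvar ^ 2 + qvar + 1
       \<and> (\<forall>n\<ge>2. P_poly n qvar = (1 + qvar + qvar ^ (2 * n)) * P_poly (n - 1) qvar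
                          + (qvar ^ (2 * n) - qvar) * P_poly (n - 2) qvar)"
proof (intro conjI allI impI)
  fix n :: nat
  show "P_poly n qvar =
      Sum_any (\<lambda>j::int. qvar powi (3 * j\<^sup>2 + 2 * j) * T1 (n + 1) (3 * j + 1) qvar)"
    using P_poly_eq_trinomial_sum[OF generic_qvar, of n] unfolding u_term_def .
next
  fix n :: nat
  assume "n \<ge> 2"
  then obtain m where "n = m + 2" using le_Suc_ex by (metis add.commute)
  then show "P_poly n qvar = (1 + qvar + qvar ^ (2 * n)) * P_poly (n - 1) qvar
                          + (qvar ^ (2 * n) - qvar) * P_poly (n - 2) qvar"
    using P_poly_rec[OF generic_qvar, of m] by simp
qed (simp_all only: P_poly_0[OF generic_qvar] P_poly_1[OF generic_qvar])

end
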